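(* Let $0\le \alpha<1$ and $\gamma>0$. There is a sequence $\{f_m(\alpha,\gamma)\}_{m=1}^{\infty}$ (independent of $j$) such that for each $m\in\mathbb N$, $$(1-\alpha)^{\gamma}\left(1+\frac{f_1}{j}\right)\left(1+\frac{f_2}{j^2}\right)\cdots\left(1+\frac{f_m}{j^m}\right)F_j = 1+O(j^{-m-1})\qquad\text{as } j\to\infty .$$
   Context: For $j\in\mathbb N$, $F_j:={}_2F_1(\gamma,j\gamma;1+j\gamma;\alpha)=\sum_{l=0}^{\infty}\alpha^l\frac{(\gamma)_l}{l!}\frac{j}{j+l/\gamma}$, where ${}_2F_1$ is the Gauss hypergeometric function and $(\gamma)_l=\gamma(\gamma+1)\cdots(\gamma+l-1)$ is the Pochhammer symbol. The implied constant in $O(\cdot)$ may depend on $m,\alpha,\gamma$. *)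

theory Defs
  imports "HOL-Analysis.Analysis" "HOL-Library.Landau_Symbols"
begin

definition hypergeo_2F1 :: "real \<Rightarrow> real \<Rightarrow> real \<Rightarrow> real \<Rightarrow> real" where
  "hypergeo_2F1 a b c z = eval_fps (fps_hypergeo [a, b] [c] 1) z"

definition F :: "real \<Rightarrow> real \<Rightarrow> nat \<Rightarrow> real" where
  "F \<alpha> \<gamma> j = hypergeo_2F1 \<gamma> (real j * \<gamma>) (1 + real j * \<gamma>) \<alpha>"

lemma hypergeo_2F1_eq_suminf:
  "hypergeo_2F1 a b c z =
    (\<Sum>n. pochhammer a n * pochhammer b n / (pochhammer c n * fact n) * z ^ n)"
  by (simp add: hypergeo_2F1_def eval_fps_def)

lemma F_sums:
  fixes \<alpha> \<gamma> :: real and j :: nat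
  assumes "0 \<le> \<alpha>" "\<alpha> < 1" "\<gamma> > 0" "j \<ge> 1"
  shows "(\<lambda>l. \<alpha> ^ l * (pochhammer \<gamma> l / fact l) * (real j / (real j + real l / \<gamma>))) sums F \<alpha> \<gamma> j"
proof -
  let ?t = "\<lambda>l. \<alpha> ^ l * (pochhammer \<gamma> l / fact l) * (real j / (real j + real l / \<gamma>))"
  have b: "real j * \<gamma> > 0" using assms by simp
  have t: "pochhammer \<gamma> n * pochhammer (real j * \<gamma>) n / (pochhammer (1 + real j * \<gamma>) n * fact n) * \<alpha> ^ n = ?t n" for n
  proof -
    define b where "b = real j * \<gamma>"
    have bpos: "b > 0" using b by (simp add: b_def)
    have pp: "pochhammer (1 + b) n > 0" using bpos by (intro pochhammer_pos) simp
    have "pochhammer b n * (b + real n) = b * pochhammer (1 + b) n"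
      using pochhammer_Suc[of b n] pochhammer_rec[of b n] by (simp add: add.commute)
    hence 1: "pochhammer b n / pochhammer (1 + b) n = b / (b + real n)"
      using pp bpos by (simp add: divide_simps add_pos_nonneg mult.commute)
    have 2: "b / (b + real n) = real j / (real j + real n / \<gamma>)"
      using assms by (simp add: b_def field_simps)
    have "pochhammer \<gamma> n * pochhammer b n / (pochhammer (1 + b) n * fact n) * \<alpha> ^ n
        = \<alpha> ^ n * (pochhammer \<gamma> n / fact n) * (pochhammer b n / pochhammer (1 + b) n)"
      by (simp add: mult_ac)
    thus ?thesis unfolding 1 2 by (simp add: b_def)
  qed
  have "(\<lambda>n. ((-\<gamma>) gchoose n) * (-\<alpha>) ^ n) sums (1 + (-\<alpha>)) powr (-\<gamma>)"
    using assms by (intro gen_binomial_real) simp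
  moreover have "((-\<gamma>) gchoose n) * (-\<alpha>) ^ n = \<alpha> ^ n * (pochhammer \<gamma> n / fact n)" for n
  proof -
    have "(- 1) ^ n * (-\<alpha>) ^ n = \<alpha> ^ n" by (simp flip: power_mult_distrib)
    thus ?thesis by (simp add: gbinomial_pochhammer mult_ac)
  qed
  ultimately have s: "summable (\<lambda>n. \<alpha> ^ n * (pochhammer \<gamma> n / fact n))"
    by (simp add: sums_iff)
  have "summable ?t"
  proof (rule summable_comparison_test'[OF s, of 0])
    fix n
    have p: "pochhammer \<gamma> n \<ge> 0" using assms by (intro pochhammer_nonneg) simp
    have q: "0 \<le> real j / (real j + real n / \<gamma>)" "real j / (real j + real n / \<gamma>) \<le> 1"
      using assms by (simp_all add: add_pos_nonneg)
    have "0 \<le> \<alpha> ^ n * (pochhammer \<gamma> n / fact n)" using p assms by simp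
    thus "norm (?t n) \<le> \<alpha> ^ n * (pochhammer \<gamma> n / fact n)"
      using mult_left_le[OF q(2)] mult_nonneg_nonneg[OF _ q(1)]
      unfolding real_norm_def by (metis abs_of_nonneg)
  qed
  thus ?thesis unfolding F_def hypergeo_2F1_eq_suminf t by (rule summable_sums)
qed

end

theory Submission
  imports Defs
begin

text \<open>
  With the negative binomial weights \<open>w\<^sub>l = (1 - \<alpha>)\<^sup>\<gamma> \<alpha>\<^sup>l (\<gamma>)\<^sub>l / l!\<close>, which add up to 1, the
  quantity \<open>(1 - \<alpha>)\<^sup>\<gamma> F\<^sub>j\<close> is the mean of \<open>1 / (1 + y\<^sub>l / j)\<close> for \<open>y\<^sub>l = l / \<gamma>\<close>. All moments of
  these weights are finite, so truncating the geometric series gives an asymptotic expansion in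
  powers of \<open>1 / j\<close> with constant term 1. The factors \<open>1 + f\<^sub>m / j\<^sup>m\<close> are then chosen one after
  the other, each cancelling the first surviving coefficient of the expansion.
\<close>

text \<open>An asymptotic series in powers of 1/j, which need not converge. Storing its coefficients
  as a formal power series makes division by j a multiplication by \<open>fps_X\<close>. The case
  \<open>n = 0\<close> says that \<open>g\<close> is bounded for large j.\<close>

definition has_expansion :: "(nat \<Rightarrow> real) \<Rightarrow> real fps \<Rightarrow> bool" where
  "has_expansion g A \<longleftrightarrow>
    (\<forall>n. (\<lambda>j. g j - (\<Sum>k<n. fps_nth A k / real j ^ k)) \<in> O(\<lambda>j. 1 / real j ^ n))"

lemma has_expansion_add:
  assumes "has_expansion g A" "has_expansion h B"
  shows "has_expansion (\<lambda>j. g j + h j) (A + B)"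
  unfolding has_expansion_def
proof
  fix n
  have "(\<lambda>j. (g j - (\<Sum>k<n. fps_nth A k / real j ^ k)) + (h j - (\<Sum>k<n. fps_nth B k / real j ^ k)))
      \<in> O(\<lambda>j. 1 / real j ^ n)"
    using assms unfolding has_expansion_def by (intro sum_in_bigo(1)) auto
  also have "(\<lambda>j. (g j - (\<Sum>k<n. fps_nth A k / real j ^ k)) + (h j - (\<Sum>k<n. fps_nth B k / real j ^ k)))
      = (\<lambda>j. g j + h j - (\<Sum>k<n. fps_nth (A + B) k / real j ^ k))"
    by (simp add: fun_eq_iff sum.distrib add_divide_distrib)
  finally show "(\<lambda>j. g j + h j - (\<Sum>k<n. fps_nth (A + B) k / real j ^ k)) \<in> O(\<lambda>j. 1 / real j ^ n)" .
qed

lemma has_expansion_cmult: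
  assumes "has_expansion g A"
  shows "has_expansion (\<lambda>j. c * g j) (fps_const c * A)"
  unfolding has_expansion_def
proof
  fix n
  have "(\<lambda>j. c * (g j - (\<Sum>k<n. fps_nth A k / real j ^ k))) \<in> O(\<lambda>j. 1 / real j ^ n)"
    using assms by (cases "c = 0") (auto simp: has_expansion_def)
  thus "(\<lambda>j. c * g j - (\<Sum>k<n. fps_nth (fps_const c * A) k / real j ^ k)) \<in> O(\<lambda>j. 1 / real j ^ n)"
    by (simp add: right_diff_distrib sum_distrib_left)
qed

text \<open>Division by j turns the error of order m into one of order m + 1. Order 0 has no
  predecessor and follows from the boundedness of \<open>g\<close>.\<close>

lemma has_expansion_X_mult:
  assumes "has_expansion g A"
  shows "has_expansion (\<lambda>j. g j / real j) (fps_X * A)"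
  unfolding has_expansion_def
proof
  fix n
  have *: "(\<lambda>j. (g j - (\<Sum>k<n. fps_nth A k / real j ^ k)) * (1 / real j))
      \<in> O(\<lambda>j. 1 / real j ^ n * (1 / real j))" for n
    using assms by (intro landau_o.big.mult) (auto simp: has_expansion_def)
  show "(\<lambda>j. g j / real j - (\<Sum>k<n. fps_nth (fps_X * A) k / real j ^ k)) \<in> O(\<lambda>j. 1 / real j ^ n)"
  proof (cases n)
    case 0
    have "(\<lambda>j. g j / real j) \<in> O(\<lambda>j. 1 / real j)" using *[of 0] by simp
    also have "(\<lambda>j. 1 / real j) \<in> O(\<lambda>j. 1)"
      by (intro bigoI[of _ 1] eventually_sequentiallyI[of 1]) simp
    finally show ?thesis using 0 by simp
  next
    case (Suc m)
    have "(\<Sum>k<n. fps_nth (fps_X * A) k / real j ^ k) = (\<Sum>k<m. fps_nth A k / real j ^ k) * (1 / real j)" for j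
      unfolding Suc sum.lessThan_Suc_shift by (simp add: sum_divide_distrib mult.commute)
    thus ?thesis using *[of m] by (simp add: Suc diff_divide_distrib mult.commute del: sum.lessThan_Suc)
  qed
qed

lemma has_expansion_X_power_mult:
  assumes "has_expansion g A"
  shows "has_expansion (\<lambda>j. g j / real j ^ k) (fps_X ^ k * A)"
proof (induction k)
  case 0
  thus ?case using assms by simp
next
  case (Suc k)
  from has_expansion_X_mult[OF this] show ?case by (simp add: mult_ac)
qed

text \<open>Multiplying out leaves a sum, a scaling and a shift, so products of two general
  expansions never arise.\<close>

lemma has_expansion_euler_factor:
  assumes "has_expansion g A"
  shows "has_expansion (\<lambda>j. (1 + c / real j ^ k) * g j) (A + fps_const c * (fps_X ^ k * A))"
  using has_expansion_add[OF assms has_expansion_cmult[OF has_expansion_X_power_mult[OF assms]], of c k]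
  by (simp add: algebra_simps)

lemma has_expansion_remainder:
  assumes "has_expansion g A" "fps_nth A 0 = 1" "\<And>i. 1 \<le> i \<Longrightarrow> i \<le> m \<Longrightarrow> fps_nth A i = 0"
  shows "(\<lambda>j. g j - 1) \<in> O(\<lambda>j. 1 / real j ^ (m + 1))"
proof -
  have "(\<Sum>k<m + 1. fps_nth A k / real j ^ k) = 1" for j
    using assms(2,3) by (simp add: sum.lessThan_Suc_shift del: sum.lessThan_Suc)
  thus ?thesis using assms(1)[unfolded has_expansion_def, rule_format, of "m + 1"] by (simp only:)
qed

text \<open>What is left of \<open>A\<close> after m factors. The next factor is 1 - b X^(m+1), with
  b the coefficient of X^(m+1) in the current series.\<close>

fun euler_remainder :: "real fps \<Rightarrow> nat \<Rightarrow> real fps" where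
  "euler_remainder A 0 = A"
| "euler_remainder A (Suc m) = (let B = euler_remainder A m in
    B + fps_const (- fps_nth B (Suc m)) * (fps_X ^ Suc m * B))"

text \<open>The factor 1 - b X^(m+1) leaves all coefficients below m + 1 untouched and, as the
  constant term is 1, changes the one at m + 1 from b to b - b = 0.\<close>

lemma euler_remainder_nth:
  assumes "fps_nth A 0 = 1"
  shows "fps_nth (euler_remainder A m) 0 = 1 \<and>
    (\<forall>i. 1 \<le> i \<and> i \<le> m \<longrightarrow> fps_nth (euler_remainder A m) i = 0)"
proof (induction m)
  case 0
  thus ?case using assms by simp
next
  case (Suc m)
  define B where "B = euler_remainder A m"
  have nth: "fps_nth (euler_remainder A (Suc m)) i =
      fps_nth B i - fps_nth B (Suc m) * (if i < Suc m then 0 else fps_nth B (i - Suc m))" for i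
    unfolding euler_remainder.simps Let_def B_def[symmetric]
    by (simp add: fps_X_power_mult_nth del: power_Suc)
  have B0: "fps_nth B 0 = 1" using Suc unfolding B_def by blast
  have B: "fps_nth B i = 0" if "1 \<le> i" "i \<le> m" for i
    using Suc that unfolding B_def by blast
  have "fps_nth (euler_remainder A (Suc m)) i = 0" if "1 \<le> i" "i \<le> Suc m" for i
  proof (cases "i = Suc m")
    case True
    thus ?thesis unfolding nth by (simp add: B0)
  next
    case False
    thus ?thesis unfolding nth using B[of i] that by simp
  qed
  moreover have "fps_nth (euler_remainder A (Suc m)) 0 = 1"
    unfolding nth by (simp add: B0)
  ultimately show ?case by blast
qed

lemma has_expansion_euler_product:
  assumes "has_expansion g A" "fps_nth A 0 = 1"
  shows "\<exists>f :: nat \<Rightarrow> real. \<forall>m.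
    (\<lambda>j. (\<Prod>k = 1..m. 1 + f k / real j ^ k) * g j - 1) \<in> O(\<lambda>j. 1 / real j ^ (m + 1))"
proof -
  \<comment> \<open>The k-th factor has to cancel coefficient k of what the first k - 1 factors
    leave. This choice does not involve m, so one sequence serves every m.\<close>
  define f where "f k = - fps_nth (euler_remainder A (k - 1)) k" for k
  have "has_expansion (\<lambda>j. (\<Prod>k = 1..m. 1 + f k / real j ^ k) * g j) (euler_remainder A m)" for m
  proof (induction m)
    case 0
    thus ?case using assms by simp
  next
    case (Suc m)
    from has_expansion_euler_factor[OF this, of "f (Suc m)" "Suc m"] show ?case
      by (simp add: Let_def f_def mult_ac del: power_Suc)
  qed
  hence "(\<lambda>j. (\<Prod>k = 1..m. 1 + f k / real j ^ k) * g j - 1) \<in> O(\<lambda>j. 1 / real j ^ (m + 1))" for m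
    by (rule has_expansion_remainder) (use euler_remainder_nth[OF assms(2), of m] in auto)
  thus ?thesis by (intro exI[of _ f] allI)
qed

text \<open>The remainder of the finite geometric sum is exactly (-z)^n / (1 + z), so the bound
  holds even for z \<ge> 1, where the infinite series diverges.\<close>

lemma geometric_remainder_bound:
  fixes z :: real
  assumes "0 \<le> z"
  shows "\<bar>1 / (1 + z) - (\<Sum>k<n. (- z) ^ k)\<bar> \<le> z ^ n"
proof -
  have "1 / (1 + z) - (\<Sum>k<n. (- z) ^ k) = (- z) ^ n / (1 + z)"
    using assms by (simp add: sum_gp_strict diff_divide_distrib)
  also have "\<bar>\<dots>\<bar> = z ^ n / (1 + z)"
    using assms by (simp add: abs_divide power_abs)
  also have "\<dots> \<le> z ^ n" using assms frac_le[of "z ^ n" "z ^ n" 1 "1 + z"] by simp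
  finally show ?thesis .
qed

text \<open>Each j / (j + y) is 1 / (1 + z) with z = y / j, and its truncation error is at most z^n
  however large y is. Averaging gives the signed moments as coefficients and the n-th moment as the
  constant in the error bound.\<close>

lemma has_expansion_moments:
  fixes w y :: "nat \<Rightarrow> real"
  assumes w: "\<And>l. 0 \<le> w l" and y: "\<And>l. 0 \<le> y l"
    and moments: "\<And>n. summable (\<lambda>l. w l * y l ^ n)"
    and g: "\<And>j. j \<ge> 1 \<Longrightarrow> (\<lambda>l. w l * (real j / (real j + y l))) sums g j"
  shows "has_expansion g (Abs_fps (\<lambda>k. \<Sum>l. w l * (- y l) ^ k))"
  unfolding has_expansion_def
proof
  fix n
  have signed: "summable (\<lambda>l. w l * (- y l) ^ k)" for k
    by (rule summable_rabs_cancel) (use moments[of k] in \<open>simp add: abs_mult power_abs w y\<close>)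
  have "norm (g j - (\<Sum>k<n. (\<Sum>l. w l * (- y l) ^ k) / real j ^ k)) \<le> (\<Sum>l. w l * y l ^ n) * norm (1 / real j ^ n)"
    if j: "j \<ge> 1" for j
  proof -
    let ?r = "\<lambda>l. w l * (real j / (real j + y l)) - (\<Sum>k<n. w l * (- y l) ^ k / real j ^ k)"
    \<comment> \<open>Only finitely many k occur, so the sums over k and l may be exchanged.\<close>
    have r: "?r sums (g j - (\<Sum>k<n. (\<Sum>l. w l * (- y l) ^ k) / real j ^ k))"
      by (intro sums_diff g j sums_sum sums_divide summable_sums signed)
    have b: "(\<lambda>l. w l * y l ^ n * (1 / real j ^ n)) sums ((\<Sum>l. w l * y l ^ n) * (1 / real j ^ n))"
      by (intro sums_mult2 summable_sums moments)
    have le: "\<bar>?r l\<bar> \<le> w l * y l ^ n * (1 / real j ^ n)" for l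
    proof -
      have "real j / (real j + y l) = 1 / (1 + y l / real j)"
        using j y[of l] by (simp add: field_simps)
      moreover have "(- (y l / real j)) ^ k = (- y l) ^ k / real j ^ k" for k
        by (simp flip: power_divide)
      ultimately have "?r l = w l * (1 / (1 + y l / real j) - (\<Sum>k<n. (- (y l / real j)) ^ k))"
        by (simp add: right_diff_distrib sum_distrib_left)
      also have "\<bar>\<dots>\<bar> \<le> w l * (y l / real j) ^ n"
        using geometric_remainder_bound[of "y l / real j" n] w[of l] y[of l]
        by (auto simp: abs_mult intro!: mult_left_mono)
      finally show ?thesis by (simp add: power_divide)
    qed
    have sr: "summable (\<lambda>l. \<bar>?r l\<bar>)"
      by (rule summable_comparison_test'[OF sums_summable[OF b], of 0]) (use le in auto)
    have "\<bar>suminf ?r\<bar> \<le> (\<Sum>l. \<bar>?r l\<bar>)" by (rule summable_rabs[OF sr])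
    also have "\<dots> \<le> (\<Sum>l. w l * y l ^ n * (1 / real j ^ n))"
      by (rule suminf_le[OF le sr sums_summable[OF b]])
    finally show ?thesis using sums_unique[OF r] sums_unique[OF b] by simp
  qed
  thus "(\<lambda>j. g j - (\<Sum>k<n. fps_nth (Abs_fps (\<lambda>k. \<Sum>l. w l * (- y l) ^ k)) k / real j ^ k))
      \<in> O(\<lambda>j. 1 / real j ^ n)"
    by (intro bigoI eventually_sequentiallyI[of 1]) simp
qed

text \<open>The operator x d/dx multiplies the l-th coefficient by l and preserves convergence in
  the open unit disc. Differentiation uses convergence nearby, hence the induction for arbitrary
  \<open>x\<close>.\<close>

lemma summable_powser_times_power:
  fixes c :: "nat \<Rightarrow> real"
  assumes "\<And>x. \<bar>x\<bar> < 1 \<Longrightarrow> summable (\<lambda>l. c l * x ^ l)" "\<bar>x\<bar> < 1"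
  shows "summable (\<lambda>l. real l ^ n * c l * x ^ l)"
  using assms(2)
proof (induction n arbitrary: x)
  case 0
  thus ?case using assms(1) by simp
next
  case (Suc n)
  have "summable (\<lambda>l. diffs (\<lambda>l. real l ^ n * c l) l * x ^ l)"
    by (rule termdiff_converges[of x 1]) (use Suc in auto)
  hence "summable (\<lambda>l. diffs (\<lambda>l. real l ^ n * c l) l * x ^ l * x)"
    by (rule summable_mult2)
  hence "summable (\<lambda>l. real (Suc l) ^ Suc n * c (Suc l) * x ^ Suc l)"
    by (simp add: diffs_def mult_ac)
  thus ?case by (subst (asm) summable_Suc_iff)
qed

text \<open>The binomial series with exponent -\<gamma> at -x; the sign in
  \<open>gbinomial_pochhammer\<close> cancels that of (-x)^l.\<close>

lemma negative_binomial_sums: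
  fixes x \<gamma> :: real
  assumes "\<bar>x\<bar> < 1"
  shows "(\<lambda>l. pochhammer \<gamma> l / fact l * x ^ l) sums ((1 - x) powr (- \<gamma>))"
proof -
  have "((- \<gamma>) gchoose l) * (- x) ^ l = pochhammer \<gamma> l / fact l * x ^ l" for l
  proof -
    have "(- 1) ^ l * (- x) ^ l = x ^ l" by (simp flip: power_mult_distrib)
    thus ?thesis by (simp add: gbinomial_pochhammer mult_ac)
  qed
  thus ?thesis using gen_binomial_real[of "- x" "- \<gamma>"] assms by simp
qed

theorem proposition2p1:
  fixes \<alpha> \<gamma> :: real
  assumes "0 \<le> \<alpha>" and "\<alpha> < 1" and "\<gamma> > 0"
  shows "\<exists>f :: nat \<Rightarrow> real. \<forall>m \<ge> 1.
    (\<lambda>j::nat. (1 - \<alpha>) powr \<gamma> * (\<Prod>k = 1..m. 1 + f k / real j ^ k) * F \<alpha> \<gamma> j - 1)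
      \<in> O(\<lambda>j. 1 / real j ^ (m + 1))"
proof -
  define w where "w l = (1 - \<alpha>) powr \<gamma> * (pochhammer \<gamma> l / fact l * \<alpha> ^ l)" for l
  define y where "y l = real l / \<gamma>" for l
  define A where "A = Abs_fps (\<lambda>k. \<Sum>l. w l * (- y l) ^ k)"
  have "w sums ((1 - \<alpha>) powr \<gamma> * (1 - \<alpha>) powr (- \<gamma>))"
    unfolding w_def using assms by (intro sums_mult negative_binomial_sums) simp
  hence "w sums 1" using assms by (simp flip: powr_add)
  \<comment> \<open>The zeroth moment is the total weight, since \<open>(- y l) ^ 0 = 1\<close> also
    at \<open>l = 0\<close>.\<close>
  hence A0: "fps_nth A 0 = 1" by (simp add: A_def sums_iff)
  have "summable (\<lambda>l. w l * y l ^ n)" for n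
  proof -
    \<comment> \<open>Up to a constant factor this is the series of the n-th moment; it converges
      because \<alpha> lies strictly inside the unit disc.\<close>
    have "summable (\<lambda>l. real l ^ n * (pochhammer \<gamma> l / fact l) * \<alpha> ^ l)"
      using assms by (intro summable_powser_times_power sums_summable[OF negative_binomial_sums]) auto
    hence "summable (\<lambda>l. (1 - \<alpha>) powr \<gamma> / \<gamma> ^ n * (real l ^ n * (pochhammer \<gamma> l / fact l) * \<alpha> ^ l))"
      by (rule summable_mult)
    thus ?thesis by (simp add: w_def y_def power_divide mult_ac)
  qed
  moreover have "(\<lambda>l. w l * (real j / (real j + y l))) sums ((1 - \<alpha>) powr \<gamma> * F \<alpha> \<gamma> j)" if "j \<ge> 1" for j
    using sums_mult[OF F_sums[OF assms that], of "(1 - \<alpha>) powr \<gamma>"] by (simp add: w_def y_def mult_ac)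
  moreover have "0 \<le> w l" "0 \<le> y l" for l
    using assms by (simp_all add: w_def y_def pochhammer_nonneg)
  ultimately have "has_expansion (\<lambda>j. (1 - \<alpha>) powr \<gamma> * F \<alpha> \<gamma> j) A"
    unfolding A_def by (intro has_expansion_moments)
  from has_expansion_euler_product[OF this A0] obtain f :: "nat \<Rightarrow> real" where
    "(\<lambda>j. (\<Prod>k = 1..m. 1 + f k / real j ^ k) * ((1 - \<alpha>) powr \<gamma> * F \<alpha> \<gamma> j) - 1)
      \<in> O(\<lambda>j. 1 / real j ^ (m + 1))" for m
    by blast
  thus ?thesis by (intro exI[of _ f]) (simp add: mult_ac)
qed

end
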